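(* Let $k\geq 2$ and $n$ be positive integers and let $\mathcal{F}\subset 2^{[n]}$ be a weakly $k$-cross-free family. Then $|\mathcal{F}|=O_{k}(n\log^{*}n)$.
   Context: $[n]=\{1,\dots,n\}$. Two sets $A,B\subset[n]$ are weakly crossing if $A\setminus B$, $B\setminus A$ and $A\cap B$ are all non-empty. A family is weakly $k$-cross-free if it does not contain $k$ pairwise weakly crossing sets. $\log^{*}n$ is the largest positive integer $i$ such that the $i$-fold iterated base-2 logarithm of $n$ exceeds $1$. $O_k(\cdot)$ means the implied constant may depend on $k$. *)

theory Defs
  imports "HOL-Analysis.Analysis"
begin

definition weakly_crossing :: "nat set \<Rightarrow> nat set \<Rightarrow> bool" where
  "weakly_crossing A B \<longleftrightarrow> A - B \<noteq> {} \<and> B - A \<noteq> {} \<and> A \<inter> B \<noteq> {}"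

definition weakly_k_cross_free :: "nat \<Rightarrow> nat set set \<Rightarrow> bool" where
  "weakly_k_cross_free k F \<longleftrightarrow>
     \<not> (\<exists>S \<subseteq> F. card S = k \<and> (\<forall>A\<in>S. \<forall>B\<in>S. A \<noteq> B \<longrightarrow> weakly_crossing A B))"

definition iter_log2 :: "nat \<Rightarrow> real \<Rightarrow> real" where
  "iter_log2 i x = ((\<lambda>y. log 2 y) ^^ i) x"

text \<open>log-star: largest positive i such that the i-fold iterated log exceeds 1
  (taking the iterates 1..i all > 1, so that log is only applied to values > 1;
  0 if no such i exists, i.e. n \<le> 2)\<close>
definition log_star :: "nat \<Rightarrow> nat" where
  "log_star n = (if iter_log2 1 (real n) > 1
                 then GREATEST i. i > 0 \<and> (\<forall>j\<in>{1..i}. iter_log2 j (real n) > 1) else 0)"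

end

theory Submission
  imports Defs
begin

text \<open>
  Pairwise intersecting sets of the family that are pairwise incomparable are pairwise weakly
  crossing, so there are fewer than \<open>k\<close> of them. Hence the block of sets with
  \<open>2 ^ i \<le> card X < 2 ^ (i + 1)\<close> is covered, up to a factor \<open>k - 1\<close>, by \<open>O(n / 2 ^ i)\<close> chains, each
  of length at most \<open>2 ^ (i + 1)\<close>, and has \<open>O(n)\<close> members.

  To gain more, consider \<open>L\<close> consecutive blocks starting at \<open>t\<close>, where \<open>L\<close> is about
  \<open>2 ^ (t / (k + 1))\<close>. Every chain step \<open>B \<subset> X\<close> is assigned a point of \<open>X - B\<close>.
  Steps adding more than \<open>L\<close> points are rare: there are \<open>O(n / L)\<close> per block. If a point is
  assigned to steps in many blocks, then all but boundedly many of these have \<open>k - 1\<close> steps in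
  higher blocks with the same point that end in a superset. Suppose a single chain had more than
  \<open>(k - 1) * L\<close> such steps with a common choice of the \<open>k - 1\<close> higher blocks. Run through these
  blocks upwards; each time take the top remaining step of the chain, pass to the step \<open>B \<subset> X\<close> of
  the higher block with the same point, keep \<open>B\<close>, and discard the at most \<open>L\<close> steps of the chain
  whose points lie outside \<open>B\<close>. The sets kept, together with the top of the chain, are \<open>k\<close>
  pairwise weakly crossing sets. As there are at most \<open>L ^ (k - 1)\<close> choices of higher blocks and
  \<open>O(n / 2 ^ t)\<close> chains in a block, the \<open>L\<close> blocks together have only \<open>O(n)\<close> members. Since \<open>L\<close> is
  exponential in \<open>t\<close>, about \<open>log* n\<close> such groups of blocks exhaust the family.
\<close>

section \<open>Two counting principles\<close>

lemma cross_free_card_less: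
  assumes "weakly_k_cross_free k F" "S \<subseteq> F"
    and "\<And>A B. A \<in> S \<Longrightarrow> B \<in> S \<Longrightarrow> A \<noteq> B \<Longrightarrow> weakly_crossing A B"
  shows "card S < k"
proof (rule ccontr)
  assume "\<not> card S < k"
  then obtain T where T: "T \<subseteq> S" "card T = k"
    by (meson not_less obtain_subset_with_card_n)
  then have "T \<subseteq> F \<and> card T = k \<and> (\<forall>A\<in>T. \<forall>B\<in>T. A \<noteq> B \<longrightarrow> weakly_crossing A B)"
    using assms by blast
  then show False
    using assms(1) unfolding weakly_k_cross_free_def by blast
qed

text \<open>Double counting of the incidences between points and sets.\<close>

lemma sum_card_le_multiplicity:
  assumes "finite V" "finite \<A>" "\<And>A. A \<in> \<A> \<Longrightarrow> A \<subseteq> V"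
    and "\<And>x. x \<in> V \<Longrightarrow> card {A \<in> \<A>. x \<in> A} \<le> m"
  shows "(\<Sum>A\<in>\<A>. card A) \<le> m * card V"
proof -
  have "(\<Sum>A\<in>\<A>. card A) = (\<Sum>A\<in>\<A>. \<Sum>x\<in>V. if x \<in> A then 1 else 0)"
  proof (rule sum.cong[OF refl])
    fix A assume "A \<in> \<A>"
    then have "V \<inter> A = A" using assms(3) by blast
    then show "card A = (\<Sum>x\<in>V. if x \<in> A then 1 else 0)"
      using assms(1) by (simp add: sum.If_cases)
  qed
  also have "\<dots> = (\<Sum>x\<in>V. \<Sum>A\<in>\<A>. if x \<in> A then 1 else 0)"
    by (rule sum.swap)
  also have "\<dots> = (\<Sum>x\<in>V. card {A \<in> \<A>. x \<in> A})"
    using assms(2) by (simp add: sum.inter_filter[symmetric])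
  also have "\<dots> \<le> (\<Sum>x\<in>V. m)"
    by (rule sum_mono) (rule assms(4))
  finally show ?thesis by (simp add: mult.commute)
qed

section \<open>Chains and antichains of sets\<close>

definition antichain_sets :: "'a set set \<Rightarrow> bool" where
  "antichain_sets S \<longleftrightarrow> (\<forall>A\<in>S. \<forall>B\<in>S. A \<subseteq> B \<longrightarrow> A = B)"

definition chain_sets :: "'a set set \<Rightarrow> bool" where
  "chain_sets S \<longleftrightarrow> (\<forall>A\<in>S. \<forall>B\<in>S. A \<subseteq> B \<or> B \<subseteq> A)"

lemma exists_minimal_subset:
  assumes "finite U" "X \<in> U"
  shows "\<exists>M\<in>U. M \<subseteq> X \<and> (\<forall>Y\<in>U. Y \<subseteq> M \<longrightarrow> Y = M)"
  using finite_has_minimal2[OF assms] by metis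

lemma chain_sets_Union_mem:
  assumes "finite C" "C \<noteq> {}" "chain_sets C"
  shows "\<Union>C \<in> C"
  using assms
proof (induction rule: finite_ne_induct)
  case (insert A C)
  then have "\<Union>C \<in> C" by (auto simp: chain_sets_def)
  then have "A \<subseteq> \<Union>C \<or> \<Union>C \<subseteq> A"
    using insert.prems unfolding chain_sets_def by blast
  then have "\<Union>(insert A C) = \<Union>C \<or> \<Union>(insert A C) = A"
    by auto
  then show ?case using \<open>\<Union>C \<in> C\<close> by auto
qed auto

lemma chain_sets_Inter_mem:
  assumes "finite C" "C \<noteq> {}" "chain_sets C"
  shows "\<Inter>C \<in> C"
  using assms
proof (induction rule: finite_ne_induct)
  case (insert A C)
  then have "\<Inter>C \<in> C" by (auto simp: chain_sets_def)
  then have "A \<subseteq> \<Inter>C \<or> \<Inter>C \<subseteq> A"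
    using insert.prems unfolding chain_sets_def by blast
  then have "\<Inter>(insert A C) = \<Inter>C \<or> \<Inter>(insert A C) = A"
    by auto
  then show ?case using \<open>\<Inter>C \<in> C\<close> by auto
qed auto

text \<open>A form of Mirsky's theorem. Peeling off the antichain of minimal members costs at most
  \<open>m\<close> sets, and the chain found in the rest grows by one, since its least member lies
  above some minimal member of \<open>U\<close>.\<close>

lemma exists_long_chain:
  assumes "finite U" and "\<And>S. S \<subseteq> U \<Longrightarrow> antichain_sets S \<Longrightarrow> card S \<le> m"
  shows "\<exists>C\<subseteq>U. chain_sets C \<and> card U \<le> m * card C"
  using assms
proof (induction "card U" arbitrary: U rule: less_induct)
  case less
  show ?case
  proof (cases "U = {}")
    case True
    then show ?thesis by (auto simp: chain_sets_def)
  next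
    case False
    define S where "S = {M \<in> U. \<forall>Y\<in>U. Y \<subseteq> M \<longrightarrow> Y = M}"
    have "antichain_sets S" "S \<subseteq> U" unfolding antichain_sets_def S_def by auto
    then have S: "card S \<le> m" using less.prems by blast
    have "S \<noteq> {}" using exists_minimal_subset[OF less.prems(1)] False unfolding S_def by blast
    then have lt: "card (U - S) < card U"
      using \<open>S \<subseteq> U\<close> less.prems(1) by (intro psubset_card_mono) auto
    obtain C where C: "C \<subseteq> U - S" "chain_sets C" "card (U - S) \<le> m * card C"
      using less.hyps[OF lt] less.prems by (metis Diff_subset finite_Diff subset_trans)
    have fC: "finite C" using C(1) less.prems(1) by (meson finite_Diff finite_subset)
    obtain M where M: "M \<in> S" "\<And>Y. Y \<in> C \<Longrightarrow> M \<subseteq> Y"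
    proof (cases "C = {}")
      case True
      then show ?thesis using that \<open>S \<noteq> {}\<close> by blast
    next
      case False
      then have "\<Inter>C \<in> U" using chain_sets_Inter_mem[OF fC _ C(2)] C(1) by blast
      then obtain M where "M \<in> S" "M \<subseteq> \<Inter>C"
        using exists_minimal_subset[OF less.prems(1)] unfolding S_def by blast
      then show ?thesis using that by blast
    qed
    have "M \<notin> C" using M C by blast
    then have "card U \<le> m * card (insert M C)"
      using S C(3) fC card_Diff_subset[of S U] \<open>S \<subseteq> U\<close> less.prems(1) finite_subset[of S U]
      by simp
    moreover have "chain_sets (insert M C)"
      using C(2) M(2) unfolding chain_sets_def by blast
    moreover have "insert M C \<subseteq> U" using M C \<open>S \<subseteq> U\<close> by blast
    ultimately show ?thesis by blast
  qed
qed

text \<open>Greedy choice: keep the least index, delete the at most \<open>m\<close> later indices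
  related to it, and repeat. Each index kept accounts for at most \<open>Suc m\<close> indices,
  itself included.\<close>

lemma exists_forward_independent_subset:
  fixes I :: "nat set"
  assumes "finite I" and "\<And>i. i \<in> I \<Longrightarrow> card {j \<in> I. i < j \<and> R i j} \<le> m"
  shows "\<exists>S\<subseteq>I. (\<forall>i\<in>S. \<forall>j\<in>S. i < j \<longrightarrow> \<not> R i j) \<and> card I \<le> Suc m * card S"
  using assms
proof (induction "card I" arbitrary: I rule: less_induct)
  case less
  show ?case
  proof (cases "I = {}")
    case False
    define i where "i = Min I"
    define N where "N = {j \<in> I. i < j \<and> R i j}"
    have i: "i \<in> I" "\<And>j. j \<in> I \<Longrightarrow> i \<le> j" using False less.prems(1) by (auto simp: i_def)
    have fN: "finite N" "N \<subseteq> I" "i \<notin> N" using less.prems(1) unfolding N_def by auto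
    have N: "card (insert i N) \<le> Suc m" using less.prems(2)[OF i(1)] fN unfolding N_def by simp
    define I' where "I' = I - insert i N"
    have I': "finite I'" "I' \<subseteq> I" "card I' < card I"
      using less.prems(1) i(1) unfolding I'_def by (auto intro!: psubset_card_mono)
    have "card {j \<in> I'. a < j \<and> R a j} \<le> m" if "a \<in> I'" for a
    proof -
      have "card {j \<in> I'. a < j \<and> R a j} \<le> card {j \<in> I. a < j \<and> R a j}"
        using I'(2) less.prems(1) by (intro card_mono) auto
      then show ?thesis using less.prems(2)[of a] that I'(2) by fastforce
    qed
    then obtain S where S: "S \<subseteq> I'" "\<forall>a\<in>S. \<forall>j\<in>S. a < j \<longrightarrow> \<not> R a j" "card I' \<le> Suc m * card S"
      using less.hyps[OF I'(3,1)] by blast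
    have "finite S" "i \<notin> S" using finite_subset[OF S(1) I'(1)] S(1) unfolding I'_def by auto
    moreover have "card I = card I' + card (insert i N)"
      unfolding I'_def using card_Diff_subset[of "insert i N" I] card_mono[of I "insert i N"] fN i(1) less.prems(1)
      by simp
    ultimately have "card I \<le> Suc m * card (insert i S)"
      using S(3) N by simp
    moreover have "\<forall>a\<in>insert i S. \<forall>j\<in>insert i S. a < j \<longrightarrow> \<not> R a j"
    proof (intro ballI impI)
      fix a j assume aj: "a \<in> insert i S" "j \<in> insert i S" "a < j"
      have "j \<noteq> i" using aj i(2) S(1) I'(2) by fastforce
      then have "j \<in> S" using aj by simp
      show "\<not> R a j"
      proof (cases "a = i")
        case True
        then show ?thesis using \<open>j \<in> S\<close> S(1) aj(3) unfolding I'_def N_def by blast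
      qed (use aj S(2) \<open>j \<in> S\<close> in blast)
    qed
    moreover have "insert i S \<subseteq> I" using S I' i by blast
    ultimately show ?thesis by blast
  qed auto
qed

text \<open>The predecessor of \<open>X\<close> in the chain \<open>C\<close>; the empty set if \<open>X\<close> is the least member.\<close>
definition below :: "'a set set \<Rightarrow> 'a set \<Rightarrow> 'a set" where
  "below C X = \<Union>{Y \<in> C. Y \<subset> X}"

definition rep :: "'a set set \<Rightarrow> 'a set \<Rightarrow> 'a" where
  "rep C X = (SOME x. x \<in> X - below C X)"

lemma below_mem:
  assumes "finite C" "chain_sets C" "below C X \<noteq> {}"
  shows "below C X \<in> C" "below C X \<subset> X"
proof -
  have "\<Union>{Y \<in> C. Y \<subset> X} \<in> {Y \<in> C. Y \<subset> X}"
  proof (rule chain_sets_Union_mem)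
    show "{Y \<in> C. Y \<subset> X} \<noteq> {}" using assms(3) unfolding below_def by blast
  qed (use assms in \<open>auto simp: chain_sets_def\<close>)
  then show "below C X \<in> C" "below C X \<subset> X" unfolding below_def by auto
qed

lemma rep_mem:
  assumes "finite C" "chain_sets C" "X \<noteq> {}"
  shows "rep C X \<in> X - below C X"
proof -
  have "\<exists>x. x \<in> X - below C X"
    using below_mem(2)[OF assms(1,2), of X] assms(3) by (cases "below C X = {}") auto
  then show ?thesis unfolding rep_def by (rule someI_ex)
qed

lemma disjoint_steps:
  assumes "chain_sets C" "X \<in> C" "Y \<in> C" "X \<noteq> Y"
  shows "(X - below C X) \<inter> (Y - below C Y) = {}"
proof -
  have "X \<subset> Y \<or> Y \<subset> X" using assms unfolding chain_sets_def by blast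
  then show ?thesis using assms unfolding below_def by blast
qed

lemma rep_inj:
  assumes "finite C" "chain_sets C" "{} \<notin> C"
  shows "inj_on (rep C) C"
proof (rule inj_onI)
  fix X Y assume XY: "X \<in> C" "Y \<in> C" "rep C X = rep C Y"
  then have "rep C X \<in> X - below C X" "rep C X \<in> Y - below C Y"
    using rep_mem[OF assms(1,2)] assms(3) by metis+
  then show "X = Y" using disjoint_steps[OF assms(2) XY(1,2)] by blast
qed

text \<open>The steps are pairwise disjoint parts of the union, and each step counted uses up more
  than \<open>L\<close> of its points.\<close>

lemma card_long_steps:
  assumes "finite C" "chain_sets C" "finite (\<Union>C)"
  shows "card {X \<in> C. L < card (X - below C X)} * L \<le> card (\<Union>C)"
proof -
  let ?S = "{X \<in> C. L < card (X - below C X)}"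
  have "card ?S * L \<le> (\<Sum>X\<in>?S. card (X - below C X))"
    using sum_mono[of ?S "\<lambda>_. L" "\<lambda>X. card (X - below C X)"] by simp
  also have "\<dots> = card (\<Union>X\<in>?S. X - below C X)"
  proof (rule card_UN_disjoint[symmetric])
    show "\<forall>X\<in>?S. finite (X - below C X)"
      using assms(3) by (metis (lifting) CollectD Sup_upper finite_Diff finite_subset)
    show "\<forall>X\<in>?S. \<forall>Y\<in>?S. X \<noteq> Y \<longrightarrow> (X - below C X) \<inter> (Y - below C Y) = {}"
      using disjoint_steps[OF assms(2)] by blast
  qed (use assms in auto)
  also have "\<dots> \<le> card (\<Union>C)"
    using assms(3) by (intro card_mono) auto
  finally show ?thesis .
qed

lemma card_chain_le_Union:
  assumes "finite C" "chain_sets C" "{} \<notin> C" "finite (\<Union>C)"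
  shows "card C \<le> card (\<Union>C)"
proof -
  have "rep C X \<in> \<Union>C" if "X \<in> C" for X
    using rep_mem[OF assms(1,2), of X] assms(3) that by (metis DiffD1 UnionI)
  then show ?thesis
    using card_inj_on_le[OF rep_inj[OF assms(1-3)] _ assms(4)] by (simp add: image_subset_iff)
qed

section \<open>Blocks of a cross-free family\<close>

locale cross_free_family =
  fixes k :: nat and V :: "nat set" and F :: "nat set set"
  assumes finite_V: "finite V" and F_sub: "F \<subseteq> Pow V"
    and cross_free: "weakly_k_cross_free k F" and k_ge: "2 \<le> k"
begin

lemma finite_F: "finite F"
  using finite_subset[OF F_sub] finite_V by simp

lemma finite_member: "X \<in> F \<Longrightarrow> finite X"
  using finite_subset[of X V] finite_V F_sub by auto

lemma crossing_family_card:
  assumes "S \<subseteq> F" "\<And>A B. A \<in> S \<Longrightarrow> B \<in> S \<Longrightarrow> A \<noteq> B \<Longrightarrow> weakly_crossing A B"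
  shows "card S \<le> k - 1"
  using cross_free_card_less[OF cross_free assms] by simp

text \<open>Incomparable sets through a common point are weakly crossing. Most uses of
  cross-freeness below go through this form.\<close>

lemma intersecting_antichain_card:
  assumes "S \<subseteq> F" "antichain_sets S" "\<And>A. A \<in> S \<Longrightarrow> x \<in> A"
  shows "card S \<le> k - 1"
proof (rule crossing_family_card[OF assms(1)])
  fix A B assume "A \<in> S" "B \<in> S" "A \<noteq> B"
  then have "\<not> A \<subseteq> B" "\<not> B \<subseteq> A" "x \<in> A" "x \<in> B"
    using assms(2) assms(3)[of A] assms(3)[of B] unfolding antichain_sets_def by auto
  then show "weakly_crossing A B" unfolding weakly_crossing_def by blast
qed

definition block :: "nat \<Rightarrow> nat set set" where
  "block i = {X \<in> F. 2 ^ i \<le> card X \<and> card X < 2 ^ Suc i}"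

definition bottoms :: "nat \<Rightarrow> nat set set" where
  "bottoms i = {M \<in> block i. \<forall>Y\<in>block i. Y \<subseteq> M \<longrightarrow> Y = M}"

text \<open>A chain holding at least a \<open>1 / (k - 1)\<close> fraction of the part of the block
  above \<open>M\<close>; \<open>chn_props\<close> shows that one exists when \<open>M\<close> is in
  \<open>bottoms i\<close>.\<close>

definition chn :: "nat \<Rightarrow> nat set \<Rightarrow> nat set set" where
  "chn i M = (SOME C. C \<subseteq> {X \<in> block i. M \<subseteq> X} \<and> chain_sets C \<and>
     card {X \<in> block i. M \<subseteq> X} \<le> (k - 1) * card C)"

definition short :: "nat \<Rightarrow> nat \<Rightarrow> nat set \<Rightarrow> nat set set" where
  "short L i M = {X \<in> chn i M. card (X - below (chn i M) X) \<le> L}"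

lemma block_sub: "block i \<subseteq> F"
  unfolding block_def by blast

lemma finite_block: "finite (block i)"
  using finite_subset[OF block_sub finite_F] .

lemma block_nonempty: "X \<in> block i \<Longrightarrow> X \<noteq> {}"
  unfolding block_def by auto

lemma block_card_less:
  assumes "X \<in> block i" "Y \<in> block j" "i < j"
  shows "card X < card Y"
proof -
  have "(2::nat) ^ Suc i \<le> 2 ^ j" using assms(3) by (intro power_increasing) auto
  then show ?thesis using assms(1,2) unfolding block_def by simp
qed

lemma block_not_subset:
  assumes "X \<in> block i" "Y \<in> block j" "i < j"
  shows "\<not> Y \<subseteq> X"
proof
  assume "Y \<subseteq> X"
  then have "card Y \<le> card X"
    using assms(1) finite_member block_sub by (meson card_mono subsetD)
  then show False using block_card_less[OF assms] by simp
qed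

lemma bottoms_sub: "bottoms i \<subseteq> block i"
  unfolding bottoms_def by blast

lemma finite_bottoms: "finite (bottoms i)"
  using finite_subset[OF bottoms_sub finite_block] .

text \<open>All members above \<open>M\<close> share a point of \<open>M\<close>, so antichains
  among them have at most \<open>k - 1\<close> members and \<open>exists_long_chain\<close>
  applies.\<close>

lemma chn_props:
  assumes "M \<in> bottoms i"
  shows "chn i M \<subseteq> {X \<in> block i. M \<subseteq> X}" "chain_sets (chn i M)"
    "card {X \<in> block i. M \<subseteq> X} \<le> (k - 1) * card (chn i M)"
proof -
  let ?U = "{X \<in> block i. M \<subseteq> X}"
  obtain x where "x \<in> M" using assms bottoms_sub block_nonempty by blast
  have "\<exists>C\<subseteq>?U. chain_sets C \<and> card ?U \<le> (k - 1) * card C"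
  proof (rule exists_long_chain)
    fix S assume "S \<subseteq> ?U" "antichain_sets S"
    then show "card S \<le> k - 1"
      using intersecting_antichain_card[of S x] block_sub \<open>x \<in> M\<close> by blast
  qed (use finite_block in auto)
  then have "\<exists>C. C \<subseteq> ?U \<and> chain_sets C \<and> card ?U \<le> (k - 1) * card C" by blast
  from someI_ex[OF this]
  show "chn i M \<subseteq> ?U" "chain_sets (chn i M)" "card ?U \<le> (k - 1) * card (chn i M)"
    unfolding chn_def by blast+
qed

lemma chn_block: "M \<in> bottoms i \<Longrightarrow> chn i M \<subseteq> block i"
  using chn_props(1) by blast

lemma finite_chn: "M \<in> bottoms i \<Longrightarrow> finite (chn i M)"
  using finite_subset[OF chn_block finite_block] .

lemma empty_notin_chn: "M \<in> bottoms i \<Longrightarrow> {} \<notin> chn i M"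
  using chn_block block_nonempty by blast

lemma chn_nonempty:
  assumes "M \<in> bottoms i"
  shows "chn i M \<noteq> {}"
proof -
  have "M \<in> {X \<in> block i. M \<subseteq> X}" using assms bottoms_sub by blast
  then have "card {X \<in> block i. M \<subseteq> X} > 0" using finite_block card_gt_0_iff by fastforce
  then show ?thesis using chn_props(3)[OF assms] by auto
qed

lemma Union_chn:
  assumes "M \<in> bottoms i"
  shows "\<Union>(chn i M) \<in> block i" "M \<subseteq> \<Union>(chn i M)"
proof -
  have "\<Union>(chn i M) \<in> chn i M"
    by (rule chain_sets_Union_mem[OF finite_chn chn_nonempty chn_props(2)]) (rule assms)+
  then show "\<Union>(chn i M) \<in> block i" "M \<subseteq> \<Union>(chn i M)"
    using chn_props(1)[OF assms] by blast+
qed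

lemma finite_Union_chn: "M \<in> bottoms i \<Longrightarrow> finite (\<Union>(chn i M))"
  using finite_member[OF subsetD[OF block_sub Union_chn(1)]] .

lemma card_Union_chn: "M \<in> bottoms i \<Longrightarrow> card (\<Union>(chn i M)) \<le> 2 * 2 ^ i"
  using Union_chn(1)[of M i] unfolding block_def by simp

section \<open>Counting the chains of a block\<close>

lemma card_bottoms_within:
  assumes "finite T"
  shows "card {M \<in> bottoms i. M \<subseteq> T} * 2 ^ i \<le> (k - 1) * card T"
proof -
  let ?A = "{M \<in> bottoms i. M \<subseteq> T}"
  have fin: "finite ?A" using finite_bottoms by auto
  have "card ?A * 2 ^ i \<le> (\<Sum>M\<in>?A. card M)"
    using sum_mono[of ?A "\<lambda>_. 2 ^ i" card] bottoms_sub by (auto simp: block_def)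
  \<comment> \<open>Minimal members form an antichain, so each point lies in at most
    \<open>k - 1\<close> of them.\<close>
  also have "\<dots> \<le> (k - 1) * card T"
  proof (rule sum_card_le_multiplicity[OF assms fin])
    fix x
    show "card {M \<in> ?A. x \<in> M} \<le> k - 1"
    proof (rule intersecting_antichain_card)
      show "antichain_sets {M \<in> ?A. x \<in> M}"
        unfolding antichain_sets_def bottoms_def by blast
    qed (use bottoms_sub block_sub in auto)
  qed auto
  finally show ?thesis .
qed

lemma card_bottoms: "card (bottoms i) * 2 ^ i \<le> (k - 1) * card V"
proof -
  have "{M \<in> bottoms i. M \<subseteq> V} = bottoms i"
    using bottoms_sub block_sub F_sub by blast
  then show ?thesis using card_bottoms_within[OF finite_V, of i] by simp
qed

lemma card_block_le_chains: "card (block i) \<le> (k - 1) * (\<Sum>M\<in>bottoms i. card (chn i M))"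
proof -
  have "block i \<subseteq> (\<Union>M\<in>bottoms i. {X \<in> block i. M \<subseteq> X})"
    using exists_minimal_subset[OF finite_block, of _ i] unfolding bottoms_def by blast
  then have "card (block i) \<le> card (\<Union>M\<in>bottoms i. {X \<in> block i. M \<subseteq> X})"
    using finite_bottoms finite_block by (intro card_mono) auto
  also have "\<dots> \<le> (\<Sum>M\<in>bottoms i. card {X \<in> block i. M \<subseteq> X})"
    by (rule card_UN_le[OF finite_bottoms])
  also have "\<dots> \<le> (\<Sum>M\<in>bottoms i. (k - 1) * card (chn i M))"
    by (rule sum_mono) (rule chn_props(3))
  finally show ?thesis by (simp add: sum_distrib_left)
qed

text \<open>There are \<open>O(n / 2 ^ i)\<close> chains, each no longer than the size of its
  largest set. This bound for a single block later handles the initial blocks.\<close>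

lemma card_block: "card (block i) \<le> 2 * (k - 1) ^ 2 * card V"
proof -
  have "card (chn i M) \<le> 2 * 2 ^ i" if M: "M \<in> bottoms i" for M
    using card_chain_le_Union[OF finite_chn[OF M] chn_props(2)[OF M] empty_notin_chn[OF M]
        finite_Union_chn[OF M]] card_Union_chn[OF M] by simp
  then have "(\<Sum>M\<in>bottoms i. card (chn i M)) \<le> card (bottoms i) * (2 * 2 ^ i)"
    using sum_bounded_above[of "bottoms i" "\<lambda>M. card (chn i M)" "2 * 2 ^ i"] by simp
  also have "\<dots> \<le> 2 * ((k - 1) * card V)" using card_bottoms[of i] by simp
  finally have "(k - 1) * (\<Sum>M\<in>bottoms i. card (chn i M)) \<le> (k - 1) * (2 * ((k - 1) * card V))"
    by (rule mult_le_mono2)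
  then show ?thesis using card_block_le_chains[of i] by (simp add: power2_eq_square algebra_simps)
qed

text \<open>The maximal ones among the tops of chains through \<open>x\<close> form an intersecting
  antichain, so there are at most \<open>k - 1\<close>. Each has fewer than \<open>2 * 2 ^ i\<close>
  points and hence contains at most \<open>2 * (k - 1)\<close> bottoms, and every bottom counted
  lies in one of them.\<close>

lemma card_chains_through:
  "card {M \<in> bottoms i. x \<in> \<Union>(chn i M)} \<le> 2 * (k - 1) ^ 2"
proof -
  let ?B = "{M \<in> bottoms i. x \<in> \<Union>(chn i M)}"
  define \<T> where "\<T> = (\<lambda>M. \<Union>(chn i M)) ` ?B"
  define mx where "mx = {T \<in> \<T>. \<forall>T'\<in>\<T>. T \<subseteq> T' \<longrightarrow> T = T'}"
  have fin: "finite \<T>" "finite mx" using finite_bottoms unfolding \<T>_def mx_def by auto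
  have sub: "\<T> \<subseteq> block i" using Union_chn(1) unfolding \<T>_def by auto
  have "card mx \<le> k - 1"
  proof (rule intersecting_antichain_card)
    show "antichain_sets mx" unfolding antichain_sets_def mx_def by blast
    show "x \<in> A" if "A \<in> mx" for A using that unfolding mx_def \<T>_def by blast
  qed (use sub block_sub mx_def in auto)
  have under: "card {M \<in> bottoms i. M \<subseteq> T} \<le> 2 * (k - 1)" if "T \<in> mx" for T
  proof -
    have T: "T \<in> block i" using that sub unfolding mx_def by blast
    then have "card {M \<in> bottoms i. M \<subseteq> T} * 2 ^ i \<le> (k - 1) * card T"
      using card_bottoms_within[OF finite_member[OF subsetD[OF block_sub]]] by blast
    also have "\<dots> \<le> (k - 1) * (2 * 2 ^ i)"
      using T unfolding block_def by (intro mult_le_mono2) auto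
    finally show ?thesis by simp
  qed
  have "?B \<subseteq> (\<Union>T\<in>mx. {M \<in> bottoms i. M \<subseteq> T})"
  proof
    fix M assume M: "M \<in> ?B"
    then have "\<Union>(chn i M) \<in> \<T>" unfolding \<T>_def by blast
    then obtain T where "T \<in> \<T>" "\<Union>(chn i M) \<subseteq> T" "\<forall>T'\<in>\<T>. T \<subseteq> T' \<longrightarrow> T = T'"
      using finite_has_maximal2[OF fin(1), of "\<Union>(chn i M)"] by auto
    then have "T \<in> mx" "M \<subseteq> T" using Union_chn(2)[of M i] M unfolding mx_def by auto
    then show "M \<in> (\<Union>T\<in>mx. {M \<in> bottoms i. M \<subseteq> T})" using M by blast
  qed
  then have "card ?B \<le> card (\<Union>T\<in>mx. {M \<in> bottoms i. M \<subseteq> T})"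
    using fin finite_bottoms by (intro card_mono) auto
  also have "\<dots> \<le> (\<Sum>T\<in>mx. card {M \<in> bottoms i. M \<subseteq> T})"
    by (rule card_UN_le[OF fin(2)])
  also have "\<dots> \<le> card mx * (2 * (k - 1))"
    using sum_bounded_above[of mx "\<lambda>T. card {M \<in> bottoms i. M \<subseteq> T}"] under by simp
  also have "\<dots> \<le> (k - 1) * (2 * (k - 1))"
    using \<open>card mx \<le> k - 1\<close> by (rule mult_le_mono1)
  finally show ?thesis by (simp add: power2_eq_square)
qed

section \<open>Steps that extend to higher blocks\<close>

text \<open>The chain in block \<open>j\<close> is quantified away and only the index
  \<open>j\<close> is recorded. This keeps the number of choices in \<open>card_good\<close> at
  \<open>L ^ (k - 1)\<close>, however many chains the blocks have.\<close>

definition extends_to :: "nat \<Rightarrow> nat set set \<Rightarrow> nat set \<Rightarrow> nat \<Rightarrow> bool" where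
  "extends_to L C X j \<longleftrightarrow>
     (\<exists>M\<in>bottoms j. \<exists>Y\<in>short L j M. rep (chn j M) Y = rep C X \<and> X \<subseteq> Y)"

text \<open>Members of block \<open>j\<close> have at least \<open>2 ^ j > L\<close> points, so a
  short step cannot start from the default value \<open>{}\<close> of \<open>below\<close>; its
  lower end is a genuine member of the chain.\<close>

lemma short_below:
  assumes "M \<in> bottoms j" "X \<in> short L j M" "L < 2 ^ j"
  shows "below (chn j M) X \<in> block j" "rep (chn j M) X \<in> X - below (chn j M) X"
    "card (X - below (chn j M) X) \<le> L"
proof -
  have X: "X \<in> block j" "X \<in> chn j M"
    using assms(2) chn_block[OF assms(1)] unfolding short_def by blast+
  show le: "card (X - below (chn j M) X) \<le> L" using assms(2) unfolding short_def by blast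
  have "below (chn j M) X \<noteq> {}"
  proof
    assume "below (chn j M) X = {}"
    then have "card X \<le> L" using le by simp
    then show False using X(1) assms(3) unfolding block_def by simp
  qed
  then show "below (chn j M) X \<in> block j"
    using below_mem(1)[OF finite_chn[OF assms(1)] chn_props(2)[OF assms(1)]] chn_block[OF assms(1)] by blast
  show "rep (chn j M) X \<in> X - below (chn j M) X"
    by (rule rep_mem[OF finite_chn[OF assms(1)] chn_props(2)[OF assms(1)] block_nonempty[OF X(1)]])
qed

text \<open>Induction that treats the least index of \<open>J\<close> first; each index costs at
  most \<open>L\<close> members of \<open>Q\<close>. The last two conclusions carry the induction:
  they make the set added for the least index meet each set found later and not be contained in
  it.\<close>

lemma exists_crossing_family:
  assumes "finite C" "chain_sets C" "{} \<notin> C"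
    and "finite J" "\<forall>j\<in>J. L < 2 ^ j"
    and "Q \<subseteq> C" "card J * L < card Q"
    and "\<forall>X\<in>Q. \<forall>j\<in>J. extends_to L C X j"
  shows "\<exists>S. S \<subseteq> (\<Union>j\<in>J. block j) \<and> card S = card J \<and>
      (\<forall>A\<in>S. \<forall>B\<in>S. A \<noteq> B \<longrightarrow> weakly_crossing A B) \<and>
      (\<exists>z\<in>rep C ` Q. \<forall>A\<in>S. z \<in> A) \<and> (\<forall>A\<in>S. \<exists>x\<in>rep C ` Q. x \<notin> A)"
  using assms(4-)
proof (induction J arbitrary: Q rule: finite_linorder_min_induct)
  case empty
  then have "Q \<noteq> {}" by auto
  then show ?case by (intro exI[of _ "{}"]) auto
next
  case (insert j J)
  have "j \<notin> J" using insert.hyps by blast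
  have L: "\<forall>j\<in>J. L < 2 ^ j" using insert.prems(1) by blast
  have finQ: "finite Q" using finite_subset[OF insert.prems(2) assms(1)] .
  have "Q \<noteq> {}" using insert.prems(3) by auto
  \<comment> \<open>Taking the top of \<open>Q\<close> ensures that \<open>Y\<close> contains every
    member of \<open>Q\<close>, and with it all their representatives.\<close>
  define X where "X = \<Union>Q"
  have "X \<in> Q"
    unfolding X_def using assms(2) insert.prems(2) finQ \<open>Q \<noteq> {}\<close>
    by (intro chain_sets_Union_mem) (auto simp: chain_sets_def)
  then obtain M Y where Y: "M \<in> bottoms j" "Y \<in> short L j M" "rep (chn j M) Y = rep C X" "X \<subseteq> Y"
    using insert.prems(4) \<open>X \<in> Q\<close> unfolding extends_to_def by blast
  define D where "D = below (chn j M) Y"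
  have D: "D \<in> block j" "rep C X \<in> Y - D" "card (Y - D) \<le> L"
    using short_below[OF Y(1,2)] insert.prems(1) Y(3) unfolding D_def by simp_all
  \<comment> \<open>The members dropped have distinct representatives in \<open>Y - D\<close>, so at
    most \<open>L\<close> are lost and \<open>card J * L < card Q'\<close> follows.\<close>
  define Q' where "Q' = {Z \<in> Q. rep C Z \<in> D}"
  have "rep C ` (Q - Q') \<subseteq> Y - D"
  proof
    fix r assume "r \<in> rep C ` (Q - Q')"
    then obtain Z where Z: "Z \<in> Q" "r = rep C Z" "r \<notin> D" unfolding Q'_def by blast
    then have "r \<in> Z" using rep_mem[OF assms(1,2), of Z] assms(3) insert.prems(2) by blast
    then show "r \<in> Y - D" using Z Y(4) unfolding X_def by blast
  qed
  moreover have "inj_on (rep C) (Q - Q')"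
    using rep_inj[OF assms(1-3)] insert.prems(2) by (meson Diff_subset inj_on_subset order_trans)
  moreover have "finite (Y - D)"
    using Y(2) finite_member[OF subsetD[OF block_sub subsetD[OF chn_block[OF Y(1)]]]]
    unfolding short_def by blast
  ultimately have "card (Q - Q') \<le> L" using card_inj_on_le[of "rep C" "Q - Q'" "Y - D"] D(3) by simp
  moreover have "card (Q - Q') = card Q - card Q'"
    using finQ unfolding Q'_def by (intro card_Diff_subset) auto
  ultimately have less: "card J * L < card Q'"
    using insert.prems(3) \<open>j \<notin> J\<close> insert.hyps(1) by simp
  have sub: "Q' \<subseteq> C" "Q' \<subseteq> Q" using insert.prems(2) unfolding Q'_def by auto
  have ext: "\<forall>X\<in>Q'. \<forall>j\<in>J. extends_to L C X j"
    using insert.prems(4) sub(2) by blast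
  obtain S z where S: "S \<subseteq> (\<Union>j\<in>J. block j)" "card S = card J"
      "\<forall>A\<in>S. \<forall>B\<in>S. A \<noteq> B \<longrightarrow> weakly_crossing A B"
      "z \<in> rep C ` Q'" "\<forall>A\<in>S. z \<in> A" "\<forall>A\<in>S. \<exists>x\<in>rep C ` Q'. x \<notin> A"
    using insert.IH[OF L sub(1) less ext] by (elim exE conjE bexE) (rule that)
  have reps_sub: "rep C ` Q' \<subseteq> rep C ` Q" using sub(2) by (rule image_mono)
  have D_reps: "rep C ` Q' \<subseteq> D" unfolding Q'_def by blast
  have z: "z \<in> rep C ` Q" "z \<in> D" using subsetD[OF reps_sub S(4)] subsetD[OF D_reps S(4)] .
  \<comment> \<open>A set in \<open>S\<close> comes from a higher block, so it is not inside
    \<open>D\<close>. It misses a representative of \<open>Q'\<close>, while \<open>D\<close>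
    contains all of these. The point \<open>z\<close> lies in both.\<close>
  have cross: "weakly_crossing A D \<and> weakly_crossing D A \<and> A \<noteq> D" if A: "A \<in> S" for A
  proof -
    obtain i where "i \<in> J" "A \<in> block i" using S(1) A by blast
    then have "\<not> A \<subseteq> D" using block_not_subset[OF D(1)] insert.hyps(2) by blast
    moreover have "\<not> D \<subseteq> A" using S(6) D_reps that by blast
    moreover have "z \<in> A \<inter> D" using S(4,5) D_reps that by blast
    ultimately show ?thesis unfolding weakly_crossing_def by blast
  qed
  have "D \<notin> S" using cross by blast
  have "finite S" using finite_subset[OF S(1)] finite_block insert.hyps(1) by blast
  show ?case
  proof (intro exI[of _ "insert D S"] conjI)
    show "insert D S \<subseteq> (\<Union>j\<in>insert j J. block j)" using S(1) D(1) by blast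
    show "card (insert D S) = card (insert j J)"
      using S(2) \<open>D \<notin> S\<close> \<open>finite S\<close> \<open>j \<notin> J\<close> insert.hyps(1) by simp
    show "\<forall>A\<in>insert D S. \<forall>B\<in>insert D S. A \<noteq> B \<longrightarrow> weakly_crossing A B"
      using S(3) cross by simp
    show "\<exists>z\<in>rep C ` Q. \<forall>A\<in>insert D S. z \<in> A"
      by (rule bexI[OF _ z(1)]) (use S(5) z(2) in simp)
    show "\<forall>A\<in>insert D S. \<exists>x\<in>rep C ` Q. x \<notin> A"
    proof
      fix A assume "A \<in> insert D S"
      then consider "A = D" | x where "x \<in> rep C ` Q'" "x \<notin> A" using S(6) by blast
      then show "\<exists>x\<in>rep C ` Q. x \<notin> A"
      proof cases
        case 1
        \<comment> \<open>The representative of the top \<open>X\<close> lies in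
          \<open>Y - D\<close>, so \<open>D\<close> misses it.\<close>
        then show ?thesis using D(2) imageI[OF \<open>X \<in> Q\<close>, of "rep C"] by blast
      next
        case 2
        then show ?thesis using subsetD[OF reps_sub] by blast
      qed
    qed
  qed
qed

text \<open>Otherwise the \<open>k - 1\<close> sets from \<open>exists_crossing_family\<close>,
  together with the top of \<open>Q\<close>, would be \<open>k\<close> pairwise weakly crossing
  sets.\<close>

lemma card_common_extension:
  assumes "M \<in> bottoms i" "Q \<subseteq> chn i M" "J \<subseteq> {i<..}" "card J = k - 1" "L < 2 ^ i"
    and "\<forall>X\<in>Q. \<forall>j\<in>J. extends_to L (chn i M) X j"
  shows "card Q \<le> (k - 1) * L"
proof (rule ccontr)
  let ?C = "chn i M"
  assume "\<not> card Q \<le> (k - 1) * L"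
  then have less: "card J * L < card Q" using assms(4) by simp
  have finJ: "finite J" using assms(4) k_ge card.infinite by fastforce
  have L: "\<forall>j\<in>J. L < 2 ^ j"
  proof
    fix j assume "j \<in> J"
    then have "(2::nat) ^ i \<le> 2 ^ j" using assms(3) by (intro power_increasing) auto
    then show "L < 2 ^ j" using assms(5) by linarith
  qed
  note C = finite_chn[OF assms(1)] chn_props(2)[OF assms(1)] empty_notin_chn[OF assms(1)]
  obtain S z where S: "S \<subseteq> (\<Union>j\<in>J. block j)" "card S = card J"
      "\<forall>A\<in>S. \<forall>B\<in>S. A \<noteq> B \<longrightarrow> weakly_crossing A B"
      "z \<in> rep ?C ` Q" "\<forall>A\<in>S. z \<in> A" "\<forall>A\<in>S. \<exists>x\<in>rep ?C ` Q. x \<notin> A"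
    using exists_crossing_family[OF C finJ L assms(2) less assms(6)]
    by (elim exE conjE bexE) (rule that)
  define D where "D = \<Union>Q"
  have "finite Q" "Q \<noteq> {}" using finite_subset[OF assms(2) C(1)] S(4) by blast+
  then have "D \<in> Q"
    unfolding D_def using C(2) assms(2)
    by (intro chain_sets_Union_mem) (auto simp: chain_sets_def)
  then have D: "D \<in> block i" using assms(2) chn_block[OF assms(1)] by blast
  have D_reps: "rep ?C ` Q \<subseteq> D"
  proof
    fix r assume "r \<in> rep ?C ` Q"
    then obtain Z where "Z \<in> Q" "r = rep ?C Z" by blast
    then show "r \<in> D" unfolding D_def
      using rep_mem[OF C(1,2), of Z] C(3) assms(2) by blast
  qed
  have cross: "weakly_crossing A D \<and> weakly_crossing D A \<and> A \<noteq> D" if A: "A \<in> S" for A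
  proof -
    obtain j where "j \<in> J" "A \<in> block j" using S(1) A by blast
    then have "\<not> A \<subseteq> D" using block_not_subset[OF D] assms(3) by blast
    moreover have "\<not> D \<subseteq> A" using S(6) D_reps that by blast
    moreover have "z \<in> A \<inter> D" using S(4,5) D_reps that by blast
    ultimately show ?thesis unfolding weakly_crossing_def by blast
  qed
  have "D \<notin> S" using cross by blast
  have "finite S" using finite_subset[OF S(1)] finite_block finJ by blast
  then have "card (insert D S) = k" using \<open>D \<notin> S\<close> S(2) assms(4) k_ge by simp
  moreover have "card (insert D S) \<le> k - 1"
  proof (rule crossing_family_card)
    show "insert D S \<subseteq> F" using S(1) D block_sub by blast
    show "weakly_crossing A B" if "A \<in> insert D S" "B \<in> insert D S" "A \<noteq> B" for A B
      using that S(3) cross by auto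
  qed
  ultimately show False using k_ge by simp
qed

section \<open>Counting good, bad and long steps\<close>

definition good :: "nat \<Rightarrow> nat \<Rightarrow> nat \<Rightarrow> nat set \<Rightarrow> nat set set" where
  "good L e i M = {X \<in> short L i M.
     \<exists>J\<subseteq>{i<..<e}. card J = k - 1 \<and> (\<forall>j\<in>J. extends_to L (chn i M) X j)}"

text \<open>A union bound over the index sets \<open>J\<close>. At most \<open>L\<close> indices lie
  strictly between \<open>i\<close> and \<open>e\<close>, so there are at most
  \<open>L ^ (k - 1)\<close> such sets, and \<open>card_common_extension\<close> bounds the
  contribution of each.\<close>

lemma card_good:
  assumes "M \<in> bottoms i" "L < 2 ^ i" "e \<le> i + L"
  shows "card (good L e i M) \<le> (k - 1) * L * L ^ (k - 1)"
proof -
  let ?J = "{J. J \<subseteq> {i<..<e} \<and> card J = k - 1}"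
  let ?Q = "\<lambda>J. {X \<in> short L i M. \<forall>j\<in>J. extends_to L (chn i M) X j}"
  have short_chn: "short L i M \<subseteq> chn i M" unfolding short_def by blast
  have finJ: "finite ?J" by simp
  have "card ?J = (card {i<..<e}) choose (k - 1)" by (rule n_subsets) simp
  also have "\<dots> \<le> card {i<..<e} ^ (k - 1)"
    by (cases "k - 1 \<le> card {i<..<e}") (auto simp: binomial_le_pow binomial_eq_0)
  also have "\<dots> \<le> L ^ (k - 1)"
    using assms(3) by (intro power_mono) auto
  finally have cJ: "card ?J \<le> L ^ (k - 1)" .
  have finQ: "finite (?Q J)" for J
    using finite_subset[OF short_chn finite_chn[OF assms(1)]] by auto
  have "good L e i M \<subseteq> (\<Union>J\<in>?J. ?Q J)"
    unfolding good_def by blast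
  then have "card (good L e i M) \<le> card (\<Union>J\<in>?J. ?Q J)"
    using finJ finQ by (intro card_mono) blast+
  also have "\<dots> \<le> (\<Sum>J\<in>?J. card (?Q J))"
    by (rule card_UN_le[OF finJ])
  also have "\<dots> \<le> (\<Sum>J\<in>?J. (k - 1) * L)"
  proof (rule sum_mono)
    fix J assume "J \<in> ?J"
    then show "card (?Q J) \<le> (k - 1) * L"
      using short_chn by (intro card_common_extension[OF assms(1) _ _ _ assms(2), of _ J]) auto
  qed
  also have "\<dots> \<le> L ^ (k - 1) * ((k - 1) * L)"
    using cJ by simp
  finally show ?thesis by (simp add: algebra_simps)
qed

text \<open>Choose for each \<open>i\<close> in \<open>I\<close> a bad step \<open>X i\<close> with
  point \<open>x\<close>. If \<open>X i\<close> were contained in \<open>k - 1\<close> later sets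
  \<open>X j\<close>, the step would be good. So a greedy choice keeps a \<open>1 / (k - 1)\<close>
  fraction of \<open>I\<close> without such inclusions; the sets kept form an antichain through
  \<open>x\<close>, hence are at most \<open>k - 1\<close>.\<close>

lemma card_bad_blocks:
  assumes "I \<subseteq> {..<e}"
    and "\<And>i. i \<in> I \<Longrightarrow> L < 2 ^ i"
    and "\<forall>i\<in>I. \<exists>M\<in>bottoms i. \<exists>X\<in>short L i M - good L e i M. rep (chn i M) X = x"
  shows "card I \<le> (k - 1) * (k - 1)"
proof -
  obtain M X where MX: "\<And>i. i \<in> I \<Longrightarrow> M i \<in> bottoms i \<and>
      X i \<in> short L i (M i) - good L e i (M i) \<and> rep (chn i (M i)) (X i) = x"
    using assms(3) by metis
  have X: "X i \<in> block i" "x \<in> X i" if "i \<in> I" for i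
    using MX[OF that] short_below(2)[of "M i" i "X i" L] assms(2)[OF that] chn_block
    unfolding short_def by blast+
  have finI: "finite I" using finite_subset[OF assms(1)] by simp
  have "card {j \<in> I. i < j \<and> X i \<subseteq> X j} \<le> k - 2" if i: "i \<in> I" for i
  proof (rule ccontr)
    assume "\<not> card {j \<in> I. i < j \<and> X i \<subseteq> X j} \<le> k - 2"
    then have "k - 1 \<le> card {j \<in> I. i < j \<and> X i \<subseteq> X j}" using k_ge by simp
    then obtain J where J: "J \<subseteq> {j \<in> I. i < j \<and> X i \<subseteq> X j}" "card J = k - 1"
      by (meson obtain_subset_with_card_n)
    have "extends_to L (chn i (M i)) (X i) j" if "j \<in> J" for j
      using J(1) that MX[of j] MX[OF i] unfolding extends_to_def
      by (metis (lifting) DiffD1 mem_Collect_eq subsetD)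
    moreover have "J \<subseteq> {i<..<e}"
      using J(1) assms(1) unfolding greaterThanLessThan_def greaterThan_def lessThan_def by blast
    ultimately have "X i \<in> good L e i (M i)"
      using MX[OF i] J(2) unfolding good_def by blast
    then show False using MX[OF i] by blast
  qed
  then obtain S where S: "S \<subseteq> I" "\<forall>i\<in>S. \<forall>j\<in>S. i < j \<longrightarrow> \<not> X i \<subseteq> X j"
      "card I \<le> Suc (k - 2) * card S"
    using exists_forward_independent_subset[OF finI, of "\<lambda>i j. X i \<subseteq> X j" "k - 2"] by blast
  \<comment> \<open>The reverse inclusion fails because sets in a higher block are larger.\<close>
  have "\<not> X i \<subseteq> X j \<and> \<not> X j \<subseteq> X i" if "i \<in> S" "j \<in> S" "i < j" for i j
    using S(1,2) that block_not_subset[OF X(1)[of i] X(1)[of j]] by blast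
  then have ne: "\<not> X i \<subseteq> X j" if "i \<in> S" "j \<in> S" "i \<noteq> j" for i j
    using that by (metis nat_neq_iff)
  have "card (X ` S) \<le> k - 1"
  proof (rule intersecting_antichain_card)
    show "antichain_sets (X ` S)" unfolding antichain_sets_def using ne by fast
    show "X ` S \<subseteq> F" using X(1) S(1) block_sub by blast
    show "x \<in> A" if "A \<in> X ` S" for A using that X(2) S(1) by blast
  qed
  moreover have "inj_on X S" unfolding inj_on_def using ne by blast
  ultimately have "card S \<le> k - 1" by (simp add: card_image)
  then have "(k - 1) * card S \<le> (k - 1) * (k - 1)" by (rule mult_le_mono2)
  moreover have "Suc (k - 2) = k - 1" using k_ge by simp
  ultimately show ?thesis using S(3) by (simp only: order_trans)
qed

text \<open>The triples \<open>(i, M, X)\<close> are counted by their representative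
  \<open>x\<close>: at most \<open>(k - 1) ^ 2\<close> blocks, at most
  \<open>2 * (k - 1) ^ 2\<close> chains through \<open>x\<close> in each, and one step per
  chain.\<close>

lemma sum_card_bad:
  assumes "L < 2 ^ t"
  shows "(\<Sum>i\<in>{t..<e}. \<Sum>M\<in>bottoms i. card (short L i M - good L e i M))
    \<le> 2 * (k - 1) ^ 4 * card V"
proof -
  define E where "E = (SIGMA i:{t..<e}. SIGMA M:bottoms i. short L i M - good L e i M)"
  define r where "r = (\<lambda>(i, M, X). rep (chn i M) X)"
  have L: "L < 2 ^ i" if "i \<ge> t" for i
  proof -
    have "(2::nat) ^ t \<le> 2 ^ i" using that by (intro power_increasing) auto
    then show ?thesis using assms by linarith
  qed
  have fin_short: "finite (short L i M - good L e i M)" if "M \<in> bottoms i" for i M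
    using finite_chn[OF that] unfolding short_def by auto
  have "(\<Sum>i\<in>{t..<e}. \<Sum>M\<in>bottoms i. card (short L i M - good L e i M)) = card E"
    unfolding E_def using finite_bottoms fin_short
    by (subst card_SigmaI; (intro ballI finite_SigmaI)?; simp add: card_SigmaI)
  also have "card E \<le> (\<Sum>x\<in>V. card {p \<in> E. r p = x})"
  proof -
    have "r p \<in> V" if "p \<in> E" for p
    proof -
      obtain i M X where p: "p = (i, M, X)" by (cases p)
      have *: "t \<le> i" "M \<in> bottoms i" "X \<in> short L i M" using that unfolding p E_def by auto
      then have "rep (chn i M) X \<in> X" using short_below(2)[OF *(2,3) L] by blast
      moreover have "X \<in> F" using * chn_block block_sub unfolding short_def by blast
      ultimately show ?thesis using F_sub unfolding p r_def by auto
    qed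
    then have "E = (\<Union>x\<in>V. {p \<in> E. r p = x})" by blast
    then show ?thesis using card_UN_le[OF finite_V, of "\<lambda>x. {p \<in> E. r p = x}"] by simp
  qed
  also have "\<dots> \<le> (\<Sum>x\<in>V. 2 * (k - 1) ^ 4)"
  proof (rule sum_mono)
    fix x
    define I where "I = {i \<in> {t..<e}. \<exists>M\<in>bottoms i. \<exists>X\<in>short L i M - good L e i M. rep (chn i M) X = x}"
    have finI: "finite I" unfolding I_def by simp
    have cI: "card I \<le> (k - 1) * (k - 1)"
      using L by (intro card_bad_blocks[of _ e L x]) (auto simp: I_def)
    let ?B = "\<lambda>i. {M \<in> bottoms i. x \<in> \<Union>(chn i M)}"
    have finB: "finite (?B i)" for i using finite_bottoms by simp
    have "card {p \<in> E. r p = x} \<le> card (SIGMA i:I. ?B i)"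
    proof (rule card_inj_on_le)
      \<comment> \<open>Within one chain the representative determines the step, so \<open>X\<close>
        may be forgotten.\<close>
      show "inj_on (\<lambda>(i, M, X). (i, M)) {p \<in> E. r p = x}"
      proof (rule inj_onI)
        fix p q assume pq: "p \<in> {p \<in> E. r p = x}" "q \<in> {p \<in> E. r p = x}"
          "(\<lambda>(i, M, X). (i, M)) p = (\<lambda>(i, M, X). (i, M)) q"
        obtain i M X Y where p: "p = (i, M, X)" and q: "q = (i, M, Y)"
          using pq(3) by (cases p; cases q) auto
        have M: "M \<in> bottoms i" and XY: "X \<in> chn i M" "Y \<in> chn i M" "rep (chn i M) X = rep (chn i M) Y"
          using pq(1,2) unfolding p q E_def r_def short_def by auto
        then have "X = Y"
          using inj_onD[OF rep_inj[OF finite_chn[OF M] chn_props(2)[OF M] empty_notin_chn[OF M]]] by blast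
        then show "p = q" using p q by simp
      qed
      show "(\<lambda>(i, M, X). (i, M)) ` {p \<in> E. r p = x} \<subseteq> (SIGMA i:I. ?B i)"
      proof
        fix q assume "q \<in> (\<lambda>(i, M, X). (i, M)) ` {p \<in> E. r p = x}"
        then obtain i M X where q: "q = (i, M)" "(i, M, X) \<in> E" "r (i, M, X) = x" by auto
        then have *: "i \<in> {t..<e}" "M \<in> bottoms i" "X \<in> short L i M - good L e i M" "rep (chn i M) X = x"
          unfolding E_def r_def by auto
        then have "i \<in> I" unfolding I_def by blast
        moreover have "x \<in> X" using short_below(2)[of M i X L] * L by auto
        moreover have "X \<in> chn i M" using * unfolding short_def by blast
        ultimately show "q \<in> (SIGMA i:I. ?B i)" using q(1) *(2) by auto
      qed
    qed (use finI finB in auto)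
    also have "\<dots> = (\<Sum>i\<in>I. card (?B i))"
      using finI finB by (intro card_SigmaI) auto
    also have "\<dots> \<le> card I * (2 * (k - 1) ^ 2)"
      using sum_bounded_above[of I "\<lambda>i. card (?B i)"] card_chains_through by simp
    also have "\<dots> \<le> (k - 1) * (k - 1) * (2 * (k - 1) ^ 2)"
      using cI by (rule mult_le_mono1)
    also have "\<dots> = 2 * (k - 1) ^ 4"
      by (simp add: power2_eq_square power4_eq_xxxx)
    finally show "card {p \<in> E. r p = x} \<le> 2 * (k - 1) ^ 4" .
  qed
  finally show ?thesis by (simp add: mult.commute)
qed

text \<open>Block \<open>i\<close> has at most \<open>(k - 1) * card V / 2 ^ i\<close> chains with
  at most \<open>2 * 2 ^ i / L\<close> long steps each; summing over \<open>L\<close> blocks cancels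
  the division by \<open>L\<close>.\<close>

lemma sum_card_long:
  assumes "0 < L"
  shows "(\<Sum>i\<in>{t..<t + L}. \<Sum>M\<in>bottoms i. card (chn i M - short L i M)) \<le> 2 * (k - 1) * card V"
proof -
  have "(\<Sum>M\<in>bottoms i. card (chn i M - short L i M)) * L \<le> 2 * (k - 1) * card V" for i
  proof -
    have "card (chn i M - short L i M) * L \<le> 2 * 2 ^ i" if M: "M \<in> bottoms i" for M
    proof -
      have "chn i M - short L i M = {X \<in> chn i M. L < card (X - below (chn i M) X)}"
        unfolding short_def by auto
      then show ?thesis
        using card_long_steps[OF finite_chn[OF M] chn_props(2)[OF M] finite_Union_chn[OF M], of L]
          card_Union_chn[OF M] by simp
    qed
    then have "(\<Sum>M\<in>bottoms i. card (chn i M - short L i M) * L) \<le> card (bottoms i) * (2 * 2 ^ i)"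
      using sum_bounded_above[of "bottoms i" "\<lambda>M. card (chn i M - short L i M) * L" "2 * 2 ^ i"] by simp
    also have "\<dots> \<le> 2 * (k - 1) * card V" using card_bottoms[of i] by simp
    finally show ?thesis by (simp add: sum_distrib_right)
  qed
  then have "(\<Sum>i\<in>{t..<t + L}. (\<Sum>M\<in>bottoms i. card (chn i M - short L i M)) * L)
      \<le> (\<Sum>i\<in>{t..<t + L}. 2 * (k - 1) * card V)"
    by (intro sum_mono)
  then have "(\<Sum>i\<in>{t..<t + L}. \<Sum>M\<in>bottoms i. card (chn i M - short L i M)) * L
      \<le> (2 * (k - 1) * card V) * L"
    by (simp add: sum_distrib_right mult.commute[of L])
  then show ?thesis using assms by simp
qed

text \<open>A chain has at most \<open>(k - 1) * L ^ k\<close> good steps. By the third hypothesis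
  this number times \<open>L\<close>, the number of blocks, is at most \<open>2 ^ t\<close>, which
  the bound on the number of chains absorbs.\<close>

lemma sum_card_good:
  assumes "0 < L" "L < 2 ^ t" "(k - 1) * L ^ (k + 1) \<le> 2 ^ t"
  shows "(\<Sum>i\<in>{t..<t + L}. \<Sum>M\<in>bottoms i. card (good L (t + L) i M)) \<le> (k - 1) * card V"
proof -
  have "(\<Sum>M\<in>bottoms i. card (good L (t + L) i M)) * L \<le> (k - 1) * card V" if i: "i \<in> {t..<t + L}" for i
  proof -
    have pow: "(2::nat) ^ t \<le> 2 ^ i" using i by (intro power_increasing) auto
    have "card (good L (t + L) i M) \<le> (k - 1) * L * L ^ (k - 1)" if "M \<in> bottoms i" for M
      using card_good[OF that, of L "t + L"] assms(2) pow i by simp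
    then have "(\<Sum>M\<in>bottoms i. card (good L (t + L) i M)) \<le> card (bottoms i) * ((k - 1) * L * L ^ (k - 1))"
      using sum_bounded_above[of "bottoms i" "\<lambda>M. card (good L (t + L) i M)"] by simp
    then have "(\<Sum>M\<in>bottoms i. card (good L (t + L) i M)) * L
        \<le> card (bottoms i) * ((k - 1) * L * L ^ (k - 1)) * L"
      by (rule mult_le_mono1)
    also have "\<dots> = card (bottoms i) * ((k - 1) * L ^ (k + 1))"
    proof -
      obtain m where "k = Suc m" using k_ge by (cases k) auto
      then show ?thesis by (simp add: algebra_simps)
    qed
    also have "\<dots> \<le> card (bottoms i) * 2 ^ i"
      using assms(3) pow by (intro mult_le_mono2) linarith
    also have "\<dots> \<le> (k - 1) * card V" by (rule card_bottoms)
    finally show ?thesis .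
  qed
  then have "(\<Sum>i\<in>{t..<t + L}. (\<Sum>M\<in>bottoms i. card (good L (t + L) i M)) * L)
      \<le> (\<Sum>i\<in>{t..<t + L}. (k - 1) * card V)"
    by (intro sum_mono)
  then have "(\<Sum>i\<in>{t..<t + L}. \<Sum>M\<in>bottoms i. card (good L (t + L) i M)) * L
      \<le> ((k - 1) * card V) * L"
    by (simp add: sum_distrib_right mult.commute[of L])
  then show ?thesis using assms by simp
qed

lemma sum_card_blocks:
  assumes "0 < L" "L < 2 ^ t" "(k - 1) * L ^ (k + 1) \<le> 2 ^ t"
  shows "(\<Sum>i\<in>{t..<t + L}. card (block i)) \<le> 5 * (k - 1) ^ 5 * card V"
proof -
  let ?I = "{t..<t + L}"
  \<comment> \<open>Every step is long, good, or bad, that is, short but not good.\<close>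
  have split: "card (chn i M) \<le> card (chn i M - short L i M) + card (good L (t + L) i M)
      + card (short L i M - good L (t + L) i M)" if M: "M \<in> bottoms i" for i M
  proof -
    let ?A = "chn i M - short L i M" and ?G = "good L (t + L) i M"
    let ?H = "short L i M - good L (t + L) i M"
    have fin: "finite (chn i M)" using finite_chn[OF M] .
    have sub: "?G \<subseteq> short L i M" "short L i M \<subseteq> chn i M" unfolding good_def short_def by auto
    have "card (chn i M) = card ((?A \<union> ?G) \<union> ?H)" using sub by (intro arg_cong[of _ _ card]) blast
    also have "\<dots> \<le> card ?A + card ?G + card ?H"
      using card_Un_le[of "?A \<union> ?G" ?H] card_Un_le[of ?A ?G] by linarith
    finally show ?thesis .
  qed
  let ?n = "card V"
  have "(\<Sum>i\<in>?I. \<Sum>M\<in>bottoms i. card (chn i M))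
      \<le> (\<Sum>i\<in>?I. \<Sum>M\<in>bottoms i. card (chn i M - short L i M) + card (good L (t + L) i M)
      + card (short L i M - good L (t + L) i M))"
    using split by (intro sum_mono)
  also have "\<dots> \<le> 2 * (k - 1) * ?n + (k - 1) * ?n + 2 * (k - 1) ^ 4 * ?n"
    unfolding sum.distrib
    using sum_card_long[OF assms(1), of t] sum_card_good[OF assms] sum_card_bad[OF assms(2), of "t + L"]
    by linarith
  \<comment> \<open>The constant is \<open>2 + 1 + 2\<close>, after raising \<open>k - 1\<close> to
    \<open>(k - 1) ^ 4\<close> in the first two terms.\<close>
  also have "\<dots> \<le> 5 * (k - 1) ^ 4 * ?n"
  proof -
    have "(k - 1) * ?n \<le> (k - 1) ^ 4 * ?n"
      using k_ge by (intro mult_le_mono1) (simp add: self_le_power)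
    then show ?thesis by simp
  qed
  finally have *: "(\<Sum>i\<in>?I. \<Sum>M\<in>bottoms i. card (chn i M)) \<le> 5 * (k - 1) ^ 4 * ?n" .
  have "(\<Sum>i\<in>?I. card (block i)) \<le> (\<Sum>i\<in>?I. (k - 1) * (\<Sum>M\<in>bottoms i. card (chn i M)))"
    by (rule sum_mono) (rule card_block_le_chains)
  also have "\<dots> = (k - 1) * (\<Sum>i\<in>?I. \<Sum>M\<in>bottoms i. card (chn i M))"
    by (simp add: sum_distrib_left)
  also have "\<dots> \<le> (k - 1) * (5 * (k - 1) ^ 4 * ?n)"
    using * by (rule mult_le_mono2)
  also have "\<dots> = 5 * (k - 1) ^ 5 * ?n"
    using power_Suc[of "k - 1" 4] by (simp add: algebra_simps)
  finally show ?thesis .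
qed

section \<open>Iterated exponentials\<close>

text \<open>The base value is large enough to give
  \<open>(k - 1) * (2 * (k + 1)) < 2 ^ levels m\<close> at every level. The groups of blocks are
  delimited by \<open>2 * (k + 1) * levels m\<close>.\<close>

fun levels :: "nat \<Rightarrow> nat" where
  "levels 0 = 2 * (k + 1)"
| "levels (Suc m) = 2 ^ levels m"

lemma levels_ge: "2 * (k + 1) \<le> levels m"
proof (induction m)
  case (Suc m)
  then show ?case using less_exp[of "levels m"] unfolding levels.simps by linarith
qed simp

text \<open>For \<open>t = c * u\<close> one has \<open>2 ^ t = (4 ^ u) ^ (k + 1)\<close>, so the
  hypotheses of \<open>sum_card_blocks\<close> follow from \<open>(k - 1) * L < 4 ^ u\<close>. This
  leaves room for an \<open>L\<close> that reaches the next level.\<close>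

lemma sum_card_level:
  "(\<Sum>i\<in>{2 * (k + 1) * levels m..<2 * (k + 1) * levels (Suc m)}. card (block i))
    \<le> 5 * (k - 1) ^ 5 * card V"
proof -
  define c where "c = 2 * (k + 1)"
  define u where "u = levels m"
  \<comment> \<open>Exactly the length with \<open>c * u + L = c * 2 ^ u\<close>, the next
    boundary.\<close>
  define L where "L = c * (2 ^ u - u)"
  have "u < 2 ^ u" by (rule less_exp)
  have "(k - 1) * c < 2 ^ u"
  proof -
    have "2 * (k - 1) < 2 * 2 ^ (k - 1)" using less_exp[of "k - 1"] by simp
    also have "\<dots> \<le> (2::nat) ^ (k + 1)"
      unfolding power_Suc[symmetric] by (intro power_increasing) auto
    finally have "2 * (k - 1) * (k + 1) < 2 ^ (k + 1) * 2 ^ (k + 1)"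
      using less_exp[of "k + 1"] by (intro mult_strict_mono) auto
    also have "\<dots> = 2 ^ (2 * (k + 1))" by (simp add: power_add[symmetric])
    also have "\<dots> \<le> 2 ^ u" unfolding u_def using levels_ge by (intro power_increasing) auto
    finally show ?thesis unfolding c_def by (simp only: ac_simps)
  qed
  then have "(k - 1) * c * 2 ^ u < 2 ^ u * 2 ^ u" by simp
  also have "\<dots> = (4::nat) ^ u" by (simp add: power_mult_distrib[symmetric])
  finally have "(k - 1) * c * 2 ^ u < 4 ^ u" .
  moreover have "(k - 1) * L \<le> (k - 1) * c * 2 ^ u"
    unfolding L_def mult.assoc by (intro mult_le_mono2) simp
  ultimately have kL: "(k - 1) * L < 4 ^ u" by linarith
  have pow: "(4 ^ u) ^ (k + 1) = (2::nat) ^ (c * u)"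
  proof -
    have "(4::nat) ^ u = 2 ^ (2 * u)" by (simp add: power_mult)
    then have "((4::nat) ^ u) ^ (k + 1) = 2 ^ (2 * u * (k + 1))" by (simp only: power_mult)
    also have "2 * u * (k + 1) = c * u" unfolding c_def by simp
    finally show ?thesis .
  qed
  have "0 < L" unfolding L_def using \<open>u < 2 ^ u\<close> by (intro mult_pos_pos) (simp_all add: c_def)
  moreover have "L < 2 ^ (c * u)"
  proof -
    have "1 * L \<le> (k - 1) * L" using k_ge by (intro mult_le_mono1) simp
    also note kL
    also have "(4::nat) ^ u \<le> (4 ^ u) ^ (k + 1)" by (rule self_le_power) auto
    finally show ?thesis unfolding pow by simp
  qed
  moreover have "(k - 1) * L ^ (k + 1) \<le> 2 ^ (c * u)"
  proof -
    have "k - 1 \<le> (k - 1) ^ (k + 1)" using k_ge by (intro self_le_power) auto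
    then have "(k - 1) * L ^ (k + 1) \<le> (k - 1) ^ (k + 1) * L ^ (k + 1)" by (rule mult_le_mono1)
    also have "\<dots> = ((k - 1) * L) ^ (k + 1)" by (simp only: power_mult_distrib)
    also have "\<dots> \<le> (4 ^ u) ^ (k + 1)" using kL by (intro power_mono) auto
    finally show ?thesis unfolding pow .
  qed
  ultimately have "(\<Sum>i\<in>{c * u..<c * u + L}. card (block i)) \<le> 5 * (k - 1) ^ 5 * card V"
    by (rule sum_card_blocks)
  moreover have "c * u + L = c * 2 ^ u"
    unfolding L_def using \<open>u < 2 ^ u\<close> by (simp add: distrib_left[symmetric])
  ultimately show ?thesis unfolding c_def u_def by simp
qed

text \<open>The first \<open>4 * (k + 1) ^ 2\<close> blocks are bounded one by one with
  \<open>card_block\<close>; each further level adds one group.\<close>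

lemma sum_card_levels:
  "(\<Sum>i<2 * (k + 1) * levels m. card (block i))
    \<le> (8 * (k + 1) ^ 2 * (k - 1) ^ 2 + m * (5 * (k - 1) ^ 5)) * card V"
proof (induction m)
  case 0
  have "(\<Sum>i<2 * (k + 1) * levels 0. card (block i))
      \<le> (2 * (k + 1) * (2 * (k + 1))) * (2 * (k - 1) ^ 2 * card V)"
    using sum_bounded_above[of "{..<2 * (k + 1) * levels 0}" "\<lambda>i. card (block i)", OF card_block]
    by (simp only: levels.simps card_lessThan of_nat_id)
  \<comment> \<open>The term \<open>0 * d\<close> produces the shape of the claim at
    \<open>m = 0\<close>.\<close>
  also have "2 * a * (2 * a) * (2 * b ^ 2 * n) = (8 * a ^ 2 * b ^ 2 + 0 * d) * n" for a b d n :: nat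
    by (simp add: power2_eq_square)
  finally show ?case .
next
  case (Suc m)
  let ?a = "2 * (k + 1) * levels m" and ?b = "2 * (k + 1) * levels (Suc m)"
  have "?a \<le> ?b" using less_exp[of "levels m"] by (intro mult_le_mono2) simp
  then have "(\<Sum>i<?b. card (block i)) = (\<Sum>i<?a. card (block i)) + (\<Sum>i\<in>{?a..<?b}. card (block i))"
    unfolding lessThan_atLeast0 by (intro sum.atLeastLessThan_concat[symmetric]) auto
  also have "\<dots> \<le> (8 * (k + 1) ^ 2 * (k - 1) ^ 2 + m * (5 * (k - 1) ^ 5)) * card V
      + 5 * (k - 1) ^ 5 * card V"
    using Suc.IH sum_card_level[of m] by (rule add_mono)
  finally show ?case by (simp add: algebra_simps)
qed

text \<open>The summand \<open>1\<close> accounts for the empty set, which lies in no block.\<close>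

lemma card_le_levels:
  assumes "\<And>i. 2 ^ i \<le> card V \<Longrightarrow> i \<le> levels m"
  shows "card F \<le> 1 + (8 * (k + 1) ^ 2 * (k - 1) ^ 2 + m * (5 * (k - 1) ^ 5)) * card V"
proof -
  let ?b = "2 * (k + 1) * levels m"
  have "F \<subseteq> insert {} (\<Union>i<?b. block i)"
  proof
    fix X assume X: "X \<in> F"
    show "X \<in> insert {} (\<Union>i<?b. block i)"
    proof (cases "X = {}")
      case False
      then have "1 \<le> card X" using finite_member[OF X] by (simp add: Suc_le_eq card_gt_0_iff)
      then obtain i where i: "2 ^ i \<le> card X" "card X < 2 ^ (i + 1)"
        using ex_power_ivl1[of 2 "card X"] by auto
      then have "X \<in> block i" using X unfolding block_def by simp
      moreover have "card X \<le> card V" using X F_sub finite_V by (intro card_mono) auto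
      then have "i \<le> levels m" using assms[of i] i(1) by simp
      then have "i < ?b" using levels_ge[of m] by simp
      ultimately show ?thesis by blast
    qed simp
  qed
  then have "card F \<le> card (insert {} (\<Union>i<?b. block i))"
    using finite_block by (intro card_mono) auto
  also have "\<dots> \<le> 1 + card (\<Union>i<?b. block i)"
    by (simp add: card_insert_if finite_block)
  also have "card (\<Union>i<?b. block i) \<le> (\<Sum>i<?b. card (block i))"
    by (rule card_UN_le) simp
  also note sum_card_levels[of m]
  finally show ?thesis by simp
qed

end

section \<open>Towers of twos and the iterated logarithm\<close>

fun tower :: "nat \<Rightarrow> nat" where
  "tower 0 = 1"
| "tower (Suc m) = 2 ^ tower m"

lemma le_tower: "m \<le> tower m"
proof (induction m)
  case (Suc m)
  then show ?case using less_exp[of "tower m"] unfolding tower.simps by linarith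
qed simp

lemma iter_log2_0: "iter_log2 0 x = x"
  unfolding iter_log2_def by simp

lemma iter_log2_Suc: "iter_log2 (Suc i) x = iter_log2 i (log 2 x)"
  unfolding iter_log2_def by (simp add: funpow_swap1)

text \<open>Undoes one logarithm at a time. The case \<open>j = 0\<close> supplies
  \<open>x > 1\<close>, which justifies passing from \<open>log 2 x\<close> back to
  \<open>x\<close>.\<close>

lemma tower_less_of_iter_log2:
  assumes "\<And>j. j \<le> i \<Longrightarrow> iter_log2 j x > 1"
  shows "real (tower i) < x"
  using assms
proof (induction i arbitrary: x)
  case 0
  then show ?case using iter_log2_0 by force
next
  case (Suc i)
  have "iter_log2 j (log 2 x) > 1" if "j \<le> i" for j
    using Suc.prems[of "Suc j"] that by (simp add: iter_log2_Suc)
  then have "real (tower i) < log 2 x" by (rule Suc.IH)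
  moreover have "x > 1" using Suc.prems[of 0] by (simp add: iter_log2_0)
  ultimately show ?case by (simp add: less_log_iff powr_realpow)
qed

lemma le_tower_of_iter_log2:
  assumes "\<And>j. j < i \<Longrightarrow> iter_log2 j x > 1" "iter_log2 i x \<le> 1"
  shows "x \<le> real (tower i)"
  using assms
proof (induction i arbitrary: x)
  case 0
  then show ?case by (simp add: iter_log2_0)
next
  case (Suc i)
  have "iter_log2 j (log 2 x) > 1" if "j < i" for j
    using Suc.prems(1)[of "Suc j"] that by (simp add: iter_log2_Suc)
  then have "log 2 x \<le> real (tower i)"
    using Suc.prems(2) by (intro Suc.IH) (auto simp: iter_log2_Suc)
  moreover have "x > 1" using Suc.prems(1)[of 0] by (simp add: iter_log2_0)
  ultimately show ?case by (simp add: log_le_iff powr_realpow)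
qed

text \<open>The iterates of \<open>n\<close> from the first onwards are the iterates of
  \<open>log 2 n\<close> from the zeroth onwards. By maximality of \<open>log_star n\<close>, the
  first one that does not exceed 1 has index \<open>log_star n\<close> in the second
  numbering.\<close>

lemma log2_le_tower_log_star: "log 2 (real n) \<le> real (tower (log_star n))"
proof (rule le_tower_of_iter_log2)
  define P where "P i \<longleftrightarrow> i > 0 \<and> (\<forall>j\<in>{1..i}. iter_log2 j (real n) > 1)" for i
  have star: "log_star n = (if iter_log2 1 (real n) > 1 then Greatest P else 0)"
    unfolding log_star_def P_def ..
  \<comment> \<open>\<open>GREATEST\<close> needs a bounded property; the bound comes from
    \<open>m \<le> tower m\<close>.\<close>
  have bound: "i \<le> Suc (nat \<lceil>log 2 (real n)\<rceil>)" if Pi: "P i" for i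
  proof -
    obtain m where m: "i = Suc m" using Pi unfolding P_def by (cases i) auto
    have "iter_log2 j (log 2 (real n)) > 1" if "j \<le> m" for j
    proof -
      have "iter_log2 (Suc j) (real n) > 1" using Pi that m unfolding P_def by simp
      then show ?thesis by (simp add: iter_log2_Suc)
    qed
    then have "real (tower m) < log 2 (real n)" by (rule tower_less_of_iter_log2)
    moreover have "real m \<le> real (tower m)" using le_tower by simp
    ultimately show ?thesis using m by linarith
  qed
  have one: "P 1" if "iter_log2 1 (real n) > 1" using that unfolding P_def by simp
  have P: "P (log_star n)" if "iter_log2 1 (real n) > 1"
    using GreatestI_nat[of P 1, OF one[OF that] bound] that unfolding star by simp
  show "1 < iter_log2 j (log 2 (real n))" if "j < log_star n" for j
  proof -
    have "P (log_star n)" using P that unfolding star by (auto split: if_splits)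
    then have "iter_log2 (Suc j) (real n) > 1" using that unfolding P_def by simp
    then show ?thesis by (simp add: iter_log2_Suc)
  qed
  show "iter_log2 (log_star n) (log 2 (real n)) \<le> 1"
  proof (cases "iter_log2 1 (real n) > 1")
    case True
    have "\<not> P (Suc (log_star n))"
      using Greatest_le_nat[of P _, OF _ bound, of "Suc (log_star n)"] True unfolding star by auto
    then have "\<not> iter_log2 (Suc (log_star n)) (real n) > 1"
      using P[OF True] unfolding P_def by (auto simp: atLeastAtMostSuc_conv)
    then show ?thesis by (simp add: iter_log2_Suc)
  next
    case False
    \<comment> \<open>Here \<open>log_star n\<close> takes its default value \<open>0\<close>, and
      the claim is that \<open>log 2 n\<close> is at most 1.\<close>
    then show ?thesis unfolding star by (simp add: iter_log2_Suc)
  qed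
qed

lemma (in cross_free_family) tower_le_levels: "tower m \<le> levels m"
  by (induction m) auto

section \<open>The bound with an explicit constant\<close>

theorem theorem2p2:
  fixes k :: nat
  assumes "k \<ge> 2"
  shows "\<exists>C::real. C > 0 \<and> (\<forall>n::nat. \<forall>F. n \<ge> 1 \<longrightarrow> F \<subseteq> Pow {1..n} \<longrightarrow>
           weakly_k_cross_free k F \<longrightarrow>
           real (card F) \<le> C * real n * real (max 1 (log_star n)))"
proof -
  \<comment> \<open>The constant is \<open>1\<close> for the empty set, plus \<open>?a\<close> for
    the initial blocks, plus \<open>?b\<close> for each group of blocks.\<close>
  let ?a = "8 * (k + 1) ^ 2 * (k - 1) ^ 2" and ?b = "5 * (k - 1) ^ 5"
  have "real (card F) \<le> real (1 + ?a + ?b) * real n * real (max 1 (log_star n))"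
    if n: "n \<ge> 1" and F: "F \<subseteq> Pow {1..n}" "weakly_k_cross_free k F" for n :: nat and F
  proof -
    interpret cross_free_family k "{1..n}" F
      using F assms by unfold_locales auto
    let ?m = "log_star n" and ?M = "max 1 (log_star n)"
    have "i \<le> levels ?m" if "2 ^ i \<le> card {1..n}" for i
    proof -
      have "real (2 ^ i) \<le> real n" using that by (subst of_nat_le_iff) simp
      then have "real i \<le> log 2 (real n)" using n by (simp add: le_log_iff powr_realpow)
      then have "i \<le> tower ?m" using log2_le_tower_log_star[of n] by linarith
      then show ?thesis using tower_le_levels le_trans by blast
    qed
    then have "card F \<le> 1 + (?a + ?m * ?b) * n" using card_le_levels[of ?m] by simp
    \<comment> \<open>The terms free of \<open>log_star n\<close> are multiplied by
      \<open>?M\<close>, which is at least 1 even for small \<open>n\<close>, where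
      \<open>log_star n\<close> is \<open>0\<close>.\<close>
    also have "\<dots> \<le> n * ?M + (?a * ?M + ?M * ?b) * n"
    proof -
      have "1 * 1 \<le> n * ?M" using n by (intro mult_le_mono) auto
      then have "1 \<le> n * ?M" by (simp only: mult_1)
      moreover have "?a * 1 + ?m * ?b \<le> ?a * ?M + ?M * ?b"
        by (intro add_mono mult_le_mono) auto
      then have "(?a + ?m * ?b) * n \<le> (?a * ?M + ?M * ?b) * n"
        by (intro mult_le_mono1) (simp only: mult_1_right)
      ultimately show ?thesis by (rule add_mono)
    qed
    also have "\<dots> = (1 + ?a + ?b) * n * ?M" by (simp add: algebra_simps)
    finally show ?thesis unfolding of_nat_mult[symmetric] by (rule of_nat_mono)
  qed
  moreover have "real (1 + ?a + ?b) > 0" by (subst of_nat_0_less_iff) simp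
  ultimately show ?thesis by blast
qed

end
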